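(* For any integer pair $(x,y)$ with $0<y<x$ and $\gcd(x,y)=1$, there exist infinitely many positive integer pairs $(c,d)$ such that there exists an $(a,b)$-regular bipartite graph $G$ of order $(n,m)$, where $n=xc$, $m=yc$, $a=yd$, $b=xd$, with $b=n-m+1$. All such pairs $(c_l,d_l)$ can be computed as $(c_l,d_l)=(c_0+lx,\;d_0+l(x-y))$ for any positive integer $l$, where $d_0$ and $(-c_0)$ are Bézout coefficients for $x$ and $(x-y)$ in $dx+(-c)(x-y)=1$.
   Context: All graphs are finite, simple and undirected. A bipartite graph $G=(U,V;E)$ has color classes $U,V$; it is of order $(n,m)$ if $|U|=n$ and $|V|=m$, and it is $(a,b)$-regular if every vertex of $U$ has degree $a$ and every vertex of $V$ has degree $b$. It is assumed throughout that $n>m>1$. Given a linear Diophantine equation $\alpha\phi+\beta\psi=\gamma$, integers $\phi$ and $\psi$ satisfying it are called Bézout coefficients for $\alpha$ and $\beta$; thus $d_0$ and $-c_0$ are integers with $d_0x+(-c_0)(x-y)=1$.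
   Formalization: For arbitrary Bézout coefficients, "all pairs, any positive l" fails (x=3, y=2, c_0=-10, d_0=-3); proved: for some choice positive l give exactly all pairs; for every choice, the pairs are the members with integer l, c,d>0, yc>1; if c_0≥0, every positive l gives a pair. *)

theory Defs
  imports Main
begin

text \<open>
  A finite simple undirected graph with colour classes \<open>U\<close> and \<open>V\<close>; an edge is the
  two-element set of its end points.
\<close>

locale bipartite_graph =
  fixes U V :: "'a set" and E :: "'a set set"
  assumes finite_U: "finite U"
    and finite_V: "finite V"
    and disjoint: "U \<inter> V = {}"
    and edges: "e \<in> E \<Longrightarrow> \<exists>u\<in>U. \<exists>v\<in>V. e = {u, v}"

definition vdegree :: "'a set set \<Rightarrow> 'a \<Rightarrow> nat" where
  "vdegree E w = card {e \<in> E. w \<in> e}"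

definition has_order :: "'a set \<Rightarrow> 'a set \<Rightarrow> nat \<Rightarrow> nat \<Rightarrow> bool" where
  "has_order U V n m \<longleftrightarrow> card U = n \<and> card V = m"

definition biregular :: "'a set \<Rightarrow> 'a set \<Rightarrow> 'a set set \<Rightarrow> nat \<Rightarrow> nat \<Rightarrow> bool" where
  "biregular U V E a b \<longleftrightarrow> (\<forall>u\<in>U. vdegree E u = a) \<and> (\<forall>v\<in>V. vdegree E v = b)"

text \<open>
  The conditions \<open>n > m > 1\<close> are the paper's standing assumption on orders; they exclude the
  pair \<open>(1, 1)\<close> when \<open>y = 1\<close>, whose only graph is a star. Vertices are taken from \<open>nat\<close>,
  which loses nothing since the graphs are finite.
\<close>

definition admissible_pairs :: "int \<Rightarrow> int \<Rightarrow> (int \<times> int) set" where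
  "admissible_pairs x y =
    {(c, d). c > 0 \<and> d > 0 \<and>
      (\<exists>n m a b :: nat.
        int n = x * c \<and> int m = y * c \<and> int a = y * d \<and> int b = x * d \<and>
        n > m \<and> m > 1 \<and>
        int b = int n - int m + 1 \<and>
        (\<exists>(U :: nat set) V E.
          bipartite_graph U V E \<and> has_order U V n m \<and> biregular U V E a b))}"

end

theory Submission
  imports Defs
begin

text \<open>
  The equation \<open>b = n - m + 1\<close> reads \<open>x d - (x - y) c = 1\<close>, whose integer solutions form the
  stated arithmetic progression because \<open>x\<close> and \<open>x - y\<close> are coprime. Conversely, for every
  positive solution the numbers satisfy \<open>n a = m b\<close> and \<open>a \<le> m\<close>, and this suffices for a
  biregular graph: list the \<open>n a\<close> edges as \<open>k = 0, 1, 2, \<dots>\<close> and let edge \<open>k\<close> join the vertex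
  \<open>k div a\<close> of the first class to the vertex \<open>k mod m\<close> of the second.
\<close>

text \<open>Equal quotients by \<open>a\<close> force the two numbers to differ by less than
  \<open>a \<le> m\<close>, while equal residues make \<open>m\<close> divide the difference, which
  is therefore zero. This will ensure that no edge is listed twice.\<close>

lemma div_mod_inj:
  fixes a m k k' :: nat
  assumes "0 < a" "a \<le> m" "k div a = k' div a" "k mod m = k' mod m"
  shows "k = k'"
proof -
  have less: "p - q < m" if "p div a = q div a" for p q
  proof -
    have "p = a * (q div a) + p mod a"
      unfolding that[symmetric] by simp
    moreover have "q = a * (q div a) + q mod a" by simp
    moreover have "p mod a < a" using assms(1) by simp
    ultimately show ?thesis using assms(2) by linarith
  qed
  have aux: "p = q" if "q \<le> p" "p div a = q div a" "p mod m = q mod m" for p q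
  proof -
    have "m dvd p - q" using that(1,3) by (simp add: mod_eq_dvd_iff_nat)
    then have "p - q = 0" using less[OF that(2)] dvd_imp_le[of m "p - q"] by linarith
    then show ?thesis using that(1) by simp
  qed
  show ?thesis
    using aux[of k k'] aux[of k' k] assms(3,4) nat_le_linear[of k k'] by auto
qed

text \<open>Gives the degrees in the first class: each vertex owns one block of \<open>a\<close>
  consecutive edge numbers.\<close>

lemma card_div_eq:
  fixes a n u :: nat
  assumes "0 < a" "u < n"
  shows "card {k. k < n * a \<and> k div a = u} = a"
proof -
  have "k < n * a \<and> k div a = u \<longleftrightarrow> u * a \<le> k \<and> k < Suc u * a" for k
  proof -
    have "k div a = u \<longleftrightarrow> u \<le> k div a \<and> k div a < Suc u"
      by (metis le_antisym less_Suc_eq_le order_refl)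
    also have "\<dots> \<longleftrightarrow> u * a \<le> k \<and> k < Suc u * a"
      using assms(1) by (simp only: less_eq_div_iff_mult_less_eq div_less_iff_less_mult)
    \<comment> \<open>The bound \<open>k < n * a\<close> is implied by \<open>k < Suc u * a\<close>,
      because \<open>Suc u \<le> n\<close>.\<close>
    finally show ?thesis
      using order.strict_trans2[OF _ mult_le_mono1[of "Suc u" n a]] assms(2)
      by (metis Suc_leI)
  qed
  then have "{k. k < n * a \<and> k div a = u} = {u * a..<Suc u * a}"
    by (simp only: set_eq_iff mem_Collect_eq atLeastLessThan_iff simp_thms)
  then show ?thesis by simp
qed

text \<open>Gives the degrees in the second class: the numbers below \<open>m * b\<close> run
  through \<open>b\<close> full periods modulo \<open>m\<close>, and every residue occurs once per
  period.\<close>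

lemma card_mod_eq:
  fixes b m r :: nat
  assumes "r < m"
  shows "card {k. k < m * b \<and> k mod m = r} = b"
proof -
  have "bij_betw (\<lambda>i. r + i * m) {..<b} {k. k < m * b \<and> k mod m = r}"
  proof (rule bij_betw_byWitness[where f' = "\<lambda>k. k div m"])
    show "(\<lambda>i. r + i * m) ` {..<b} \<subseteq> {k. k < m * b \<and> k mod m = r}"
    proof (rule image_subsetI)
      fix i assume "i \<in> {..<b}"
      then have "Suc i * m \<le> b * m" by (intro mult_le_mono1) simp
      then show "r + i * m \<in> {k. k < m * b \<and> k mod m = r}"
        using assms by (simp add: mult.commute)
    qed
    show "(\<lambda>k. k div m) ` {k. k < m * b \<and> k mod m = r} \<subseteq> {..<b}"
      by (auto simp: less_mult_imp_div_less mult.commute)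
  qed (use assms in auto)
  from bij_betw_same_card[OF this] show ?thesis by simp
qed

lemma biregular_bipartite_graph_exists:
  fixes n m a b :: nat
  assumes "0 < a" "a \<le> m" "n * a = m * b"
  shows "\<exists>(U :: nat set) V E. bipartite_graph U V E \<and> has_order U V n m \<and> biregular U V E a b"
proof -
  \<comment> \<open>The shift by \<open>n\<close> keeps the two classes disjoint inside the natural
    numbers.\<close>
  define e where "e k = {k div a, n + k mod m}" for k
  let ?U = "{..<n}" and ?V = "{n..<n + m}" and ?E = "e ` {..<n * a}"
  have m: "0 < m" using assms by simp
  have left: "k div a < n" if "k < n * a" for k
    using that by (rule less_mult_imp_div_less)
  have in_left: "u \<in> e k \<longleftrightarrow> k div a = u" if "u < n" for u k
    using that by (auto simp: e_def)
  have in_right: "n + r \<in> e k \<longleftrightarrow> k mod m = r" if "k < n * a" for r k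
    using left[OF that] by (auto simp: e_def)
  have inj: "inj_on e {..<n * a}"
  proof (rule inj_onI)
    fix k k' assume k: "k \<in> {..<n * a}" "k' \<in> {..<n * a}" and eq: "e k = e k'"
    \<comment> \<open>Both end points can be read off the unordered edge, since exactly one of them
      lies below \<open>n\<close>.\<close>
    have "k div a = k' div a"
      using in_left[OF left, of k k'] in_left[OF left, of k k] k eq by simp
    moreover have "k mod m = k' mod m"
      using in_right[of k "k' mod m"] in_right[of k' "k' mod m"] k eq by simp
    ultimately show "k = k'" by (rule div_mod_inj[OF assms(1,2)])
  qed
  \<comment> \<open>Injectivity of \<open>e\<close> turns counting edges at a vertex into counting
    edge numbers.\<close>
  have degree: "vdegree ?E w = card {k. k < n * a \<and> w \<in> e k}" for w
  proof -
    have "{f \<in> ?E. w \<in> f} = e ` {k. k < n * a \<and> w \<in> e k}" by auto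
    moreover have "inj_on e {k. k < n * a \<and> w \<in> e k}"
      by (rule inj_on_subset[OF inj]) auto
    ultimately show ?thesis by (simp add: vdegree_def card_image)
  qed
  have "bipartite_graph ?U ?V ?E"
  proof
    fix f assume "f \<in> ?E"
    then obtain k where "k < n * a" "f = e k" by auto
    then show "\<exists>u\<in>?U. \<exists>v\<in>?V. f = {u, v}"
      using left m by (intro bexI[of _ "k div a"] bexI[of _ "n + k mod m"]) (auto simp: e_def)
  qed auto
  moreover have "has_order ?U ?V n m" by (simp add: has_order_def)
  moreover have "biregular ?U ?V ?E a b"
    unfolding biregular_def
  proof (intro conjI ballI)
    fix u assume "u \<in> ?U"
    then show "vdegree ?E u = a"
      using in_left[of u] card_div_eq[OF assms(1), of u n] by (simp add: degree)
  next
    fix v assume "v \<in> ?V"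
    then obtain r where r: "v = n + r" "r < m"
      by (metis add_less_cancel_left atLeastLessThan_iff le_iff_add)
    \<comment> \<open>Rewriting \<open>n * a\<close> as \<open>m * b\<close> shows the list of edges
      as \<open>b\<close> full periods modulo \<open>m\<close>.\<close>
    have "{k. k < n * a \<and> v \<in> e k} = {k. k < m * b \<and> k mod m = r}"
      using in_right r assms(3) by auto
    then show "vdegree ?E v = b"
      using card_mod_eq[OF r(2)] by (simp add: degree)
  qed
  ultimately show ?thesis by blast
qed

text \<open>Both \<open>n * a\<close> and \<open>m * b\<close> equal \<open>x * y * c * d\<close>,
  so the edge count balances automatically; besides positivity, only \<open>m > 1\<close> and the
  equation for \<open>b\<close> remain as constraints.\<close>

lemma admissible_pairs_eq:
  fixes x y :: int
  assumes "0 < y" "y < x"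
  shows "admissible_pairs x y =
    {(c, d). 0 < c \<and> 0 < d \<and> 1 < y * c \<and> d * x - c * (x - y) = 1}"
proof -
  have "(c, d) \<in> admissible_pairs x y"
    if cd: "0 < c" "0 < d" "1 < y * c" "d * x - c * (x - y) = 1" for c d
  proof -
    \<comment> \<open>The equation gives \<open>x * d = x * c - (y * c - 1)\<close>, and
      \<open>y * c > 1\<close>. The resulting \<open>d \<le> c\<close> yields
      \<open>a \<le> m\<close>, as the construction requires.\<close>
    have "x * d \<le> x * c"
      using cd(3,4) by (simp add: algebra_simps)
    then have "d \<le> c" using assms by simp
    then have le: "y * d \<le> y * c" using assms(1) by simp
    have less: "y * c < x * c" using assms(2) cd(1) by simp
    have pos: "0 < y * d" "0 < x * d" using assms cd(2) by simp_all
    define n m a b where "n = nat (x * c)" and "m = nat (y * c)"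
      and "a = nat (y * d)" and "b = nat (x * d)"
    have int: "int n = x * c" "int m = y * c" "int a = y * d" "int b = x * d"
      using less pos cd(3) by (simp_all add: n_def m_def a_def b_def)
    have "int (n * a) = int (m * b)" using int by simp
    then have "n * a = m * b" by (simp only: of_nat_eq_iff)
    moreover have "0 < a" "a \<le> m" using int le pos by linarith+
    ultimately have graph: "\<exists>(U :: nat set) V E.
        bipartite_graph U V E \<and> has_order U V n m \<and> biregular U V E a b"
      by (intro biregular_bipartite_graph_exists)
    have "int b = int n - int m + 1" using cd(4) by (simp add: int algebra_simps)
    moreover have "m < n" "1 < m" using int less cd(3) by linarith+
    ultimately show ?thesis
      using graph int cd(1,2) unfolding admissible_pairs_def by blast
  qed
  moreover have "0 < c \<and> 0 < d \<and> 1 < y * c \<and> d * x - c * (x - y) = 1"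
    if adm: "(c, d) \<in> admissible_pairs x y" for c d
  proof -
    obtain n m a b :: nat where h: "0 < c" "0 < d" "int n = x * c" "int m = y * c"
      "int b = x * d" "1 < m" "int b = int n - int m + 1"
      using adm unfolding admissible_pairs_def by blast
    moreover have "1 < y * c" using h(4,6) by linarith
    moreover have "d * x - c * (x - y) = 1"
      using h(3,4,5,7) by (simp add: algebra_simps)
    ultimately show ?thesis by blast
  qed
  ultimately show ?thesis by blast
qed

lemma linear_diophantine_solutions:
  fixes x z c d c\<^sub>0 d\<^sub>0 :: int
  assumes "x \<noteq> 0" "d\<^sub>0 * x - c\<^sub>0 * z = 1"
  shows "d * x - c * z = 1 \<longleftrightarrow> (\<exists>l. c = c\<^sub>0 + l * x \<and> d = d\<^sub>0 + l * z)"
proof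
  assume eq: "d * x - c * z = 1"
  \<comment> \<open>Each of \<open>c\<close> and \<open>c\<^sub>0\<close> is multiplied by the left
    side of the other pair's equation, which is 1. The terms in \<open>z\<close> cancel, leaving
    \<open>c * d\<^sub>0 - d * c\<^sub>0\<close> times \<open>x\<close>.\<close>
  have "c - c\<^sub>0 = (d * c\<^sub>0 * x - c * c\<^sub>0 * z) * -1 + c * (d\<^sub>0 * x - c\<^sub>0 * z)"
  proof -
    have "d * c\<^sub>0 * x - c * c\<^sub>0 * z = c\<^sub>0 * (d * x - c * z)" by (simp add: algebra_simps)
    then show ?thesis using eq assms(2) by simp
  qed
  then have "c = c\<^sub>0 + (c * d\<^sub>0 - d * c\<^sub>0) * x" by (simp add: algebra_simps)
  then obtain l where c: "c = c\<^sub>0 + l * x" by blast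
  have "x * d = 1 + (c\<^sub>0 + l * x) * z" using eq c by (simp add: algebra_simps)
  also have "\<dots> = x * (d\<^sub>0 + l * z)"
    using assms(2) by (simp add: algebra_simps)
  finally have "d = d\<^sub>0 + l * z"
    using assms(1) by simp
  with c show "\<exists>l. c = c\<^sub>0 + l * x \<and> d = d\<^sub>0 + l * z" by blast
qed (use assms(2) in \<open>auto simp: algebra_simps\<close>)

text \<open>Bezout coefficients are determined only up to a shift of \<open>l\<close>, so positive
  \<open>l\<close> can describe the admissible pairs exactly only for a normalised
  \<open>c\<^sub>0\<close>. For arbitrary coefficients \<open>l\<close> ranges over all integers and
  the positivity conditions select the pairs.\<close>

theorem proposition4p5:
  fixes x y :: int
  assumes "0 < y" and "y < x" and "gcd x y = 1"
  shows "infinite (admissible_pairs x y)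
    \<and> (\<forall>c\<^sub>0 d\<^sub>0 :: int. d\<^sub>0 * x + (- c\<^sub>0) * (x - y) = 1 \<longrightarrow>
         admissible_pairs x y =
           {(c, d). c > 0 \<and> d > 0 \<and> y * c > 1 \<and>
                    (\<exists>l :: int. c = c\<^sub>0 + l * x \<and> d = d\<^sub>0 + l * (x - y))}
         \<and> (c\<^sub>0 \<ge> 0 \<longrightarrow>
              (\<forall>l :: int. l > 0 \<longrightarrow> (c\<^sub>0 + l * x, d\<^sub>0 + l * (x - y)) \<in> admissible_pairs x y)))
    \<and> (\<exists>c\<^sub>0 d\<^sub>0 :: int. d\<^sub>0 * x + (- c\<^sub>0) * (x - y) = 1 \<and>
         admissible_pairs x y = {(c\<^sub>0 + l * x, d\<^sub>0 + l * (x - y)) | l :: int. l > 0})"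
proof -
  have x: "0 < x" "x \<noteq> 0" using assms by auto
  \<comment> \<open>Positivity of \<open>d\<close> follows from that of \<open>c\<close>, so
    admissibility of a solution depends on \<open>c\<close> alone.\<close>
  have snd_pos: "0 < d" if "0 < c" "d * x - c * (x - y) = 1" for c d
  proof -
    have "0 < c * (x - y)" using that(1) assms(2) by simp
    then have "0 < d * x" using that(2) by linarith
    then show ?thesis using x(1) by (simp add: zero_less_mult_iff)
  qed
  have general: "admissible_pairs x y =
      {(c, d). c > 0 \<and> d > 0 \<and> y * c > 1 \<and> (\<exists>l. c = c\<^sub>0 + l * x \<and> d = d\<^sub>0 + l * (x - y))}"
    if "d\<^sub>0 * x - c\<^sub>0 * (x - y) = 1" for c\<^sub>0 d\<^sub>0
    by (simp add: admissible_pairs_eq[OF assms(1,2)] linear_diophantine_solutions[OF x(2) that])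
  \<comment> \<open>the least \<open>c\<close> allowed by \<open>c > 0\<close> and \<open>y * c > 1\<close>\<close>
  define t :: int where "t = (if y = 1 then 2 else 1)"
  have t: "0 < c \<and> 1 < y * c \<longleftrightarrow> t \<le> c" for c
  proof (cases "y = 1")
    case False
    have "1 < y * c" if "0 < c" for c
    proof -
      have "y * 1 \<le> y * c" using assms(1) that by (intro mult_left_mono) auto
      then show ?thesis using False assms(1) by linarith
    qed
    then show ?thesis using False by (auto simp: t_def)
  qed (auto simp: t_def)
  \<comment> \<open>Since \<open>x > y \<ge> 1\<close> gives \<open>x \<ge> 2\<close>, one step of
    length \<open>x\<close> from any nonnegative \<open>c\<^sub>0\<close> already reaches the
    threshold.\<close>
  have "t \<le> x" using assms by (auto simp: t_def)
  have mem: "(c\<^sub>0 + l * x, d\<^sub>0 + l * (x - y)) \<in> admissible_pairs x y"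
    if "d\<^sub>0 * x - c\<^sub>0 * (x - y) = 1" "t \<le> c\<^sub>0 + l * x" for c\<^sub>0 d\<^sub>0 l
  proof -
    let ?c = "c\<^sub>0 + l * x" and ?d = "d\<^sub>0 + l * (x - y)"
    have eq: "?d * x - ?c * (x - y) = 1"
      using linear_diophantine_solutions[OF x(2) that(1)] by blast
    moreover have "0 < ?c" "1 < y * ?c" using t that(2) by blast+
    ultimately show ?thesis
      using snd_pos[OF _ eq] by (simp add: admissible_pairs_eq[OF assms(1,2)])
  qed
  have nonneg: "(c\<^sub>0 + l * x, d\<^sub>0 + l * (x - y)) \<in> admissible_pairs x y"
    if "d\<^sub>0 * x - c\<^sub>0 * (x - y) = 1" "0 \<le> c\<^sub>0" "0 < l" for c\<^sub>0 d\<^sub>0 l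
  proof -
    have "x \<le> l * x" using that(3) x(1) by simp
    then show ?thesis using mem[OF that(1), of l] that(2) \<open>t \<le> x\<close> by linarith
  qed
  have "gcd x (x - y) = 1"
    using assms(3) gcd_add_mult[of x "-1" y] gcd_neg2[of x "x - y"] by simp
  then obtain p q where pq: "p * x + q * (x - y) = 1"
    by (metis bezout_int)
  \<comment> \<open>\<open>c\<^sub>0 + x\<close> is the least admissible \<open>c\<close>\<close>
  define j where "j = (- q - t) div x"
  \<comment> \<open>Subtracting \<open>j * x\<close> moves \<open>- q\<close> into the window from
    \<open>t\<close> to \<open>t + x - 1\<close>; the further \<open>- x\<close> makes
    \<open>l = 1\<close>, not \<open>l = 0\<close>, the first admissible index.\<close>
  define c\<^sub>0 d\<^sub>0 where "c\<^sub>0 = - q + (- j - 1) * x" and "d\<^sub>0 = p + (- j - 1) * (x - y)"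
  have sol: "d\<^sub>0 * x - c\<^sub>0 * (x - y) = 1"
    using pq unfolding c\<^sub>0_def d\<^sub>0_def by (simp add: algebra_simps)
  have c0: "c\<^sub>0 + x = t + (- q - t) mod x"
    unfolding c\<^sub>0_def j_def minus_div_mult_eq_mod[symmetric] by (simp add: algebra_simps)
  have bounds: "t \<le> c\<^sub>0 + x" "c\<^sub>0 < t"
    using c0 x(1) pos_mod_sign[of x "- q - t"] pos_mod_bound[of x "- q - t"] by linarith+
  have range: "admissible_pairs x y = {(c\<^sub>0 + l * x, d\<^sub>0 + l * (x - y)) | l. l > 0}"
  proof (rule set_eqI)
    fix z :: "int \<times> int"
    \<comment> \<open>As \<open>c\<^sub>0 < t \<le> c\<^sub>0 + x\<close>, the threshold is crossed
      exactly between \<open>l = 0\<close> and \<open>l = 1\<close>.\<close>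
    have pos: "t \<le> c\<^sub>0 + l * x \<longleftrightarrow> 0 < l" for l
    proof
      assume "t \<le> c\<^sub>0 + l * x"
      then have "0 < l * x" using bounds(2) by linarith
      then show "0 < l" using x(1) by (simp add: zero_less_mult_iff)
    next
      assume "0 < l"
      then have "x \<le> l * x" using x(1) by simp
      then show "t \<le> c\<^sub>0 + l * x" using bounds(1) by linarith
    qed
    show "z \<in> admissible_pairs x y
        \<longleftrightarrow> z \<in> {(c\<^sub>0 + l * x, d\<^sub>0 + l * (x - y)) | l. l > 0}"
    proof
      assume "z \<in> admissible_pairs x y"
      then obtain l where z: "z = (c\<^sub>0 + l * x, d\<^sub>0 + l * (x - y))"
        and "0 < c\<^sub>0 + l * x" "1 < y * (c\<^sub>0 + l * x)"
        unfolding general[OF sol] by auto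
      then have "0 < l" using t pos by blast
      then show "z \<in> {(c\<^sub>0 + l * x, d\<^sub>0 + l * (x - y)) | l. l > 0}" using z by blast
    qed (use mem[OF sol] pos in blast)
  qed
  have "inj_on (\<lambda>l. (c\<^sub>0 + l * x, d\<^sub>0 + l * (x - y))) {0<..}"
    using x(2) by (auto simp: inj_on_def)
  then have "infinite ((\<lambda>l. (c\<^sub>0 + l * x, d\<^sub>0 + l * (x - y))) ` {0<..})"
    by (simp add: finite_image_iff infinite_Ioi)
  moreover have "(\<lambda>l. (c\<^sub>0 + l * x, d\<^sub>0 + l * (x - y))) ` {0<..} = admissible_pairs x y"
    unfolding range by auto
  ultimately have inf: "infinite (admissible_pairs x y)" by simp
  show ?thesis
  proof (intro conjI allI impI)
    show "infinite (admissible_pairs x y)" by (rule inf)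
  next
    fix c d :: int
    assume "d * x + (- c) * (x - y) = 1"
    then have eq: "d * x - c * (x - y) = 1" by simp
    show "admissible_pairs x y = {(c', d'). c' > 0 \<and> d' > 0 \<and> y * c' > 1 \<and>
        (\<exists>l. c' = c + l * x \<and> d' = d + l * (x - y))}"
      by (rule general[OF eq])
    fix l :: int
    assume "0 \<le> c" "0 < l"
    then show "(c + l * x, d + l * (x - y)) \<in> admissible_pairs x y"
      by (rule nonneg[OF eq])
  next
    show "\<exists>c\<^sub>0 d\<^sub>0 :: int. d\<^sub>0 * x + (- c\<^sub>0) * (x - y) = 1 \<and>
        admissible_pairs x y = {(c\<^sub>0 + l * x, d\<^sub>0 + l * (x - y)) | l :: int. l > 0}"
      using sol range by (intro exI[of _ c\<^sub>0] exI[of _ d\<^sub>0]) simp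
  qed
qed

end
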